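(* Let $B$ be a skew brace. Then $B$ has property (BS) if and only if $B^{(2)}$ and $[B,B]_+$ are finite.
   Context: A skew (left) brace is a triple $(B,+,\circ)$ where $(B,+)$ and $(B,\circ)$ are (not necessarily abelian) groups such that $a\circ(b+c)=a\circ b-a+a\circ c$ for all $a,b,c\in B$. The two identities coincide and are denoted $0$. Put $a\ast b=-a+a\circ b-b$. $B^{(2)}=B\ast B$ is the subgroup of $(B,+)$ generated by all $a\ast b$ with $a,b\in B$, and $[B,B]_+$ is the commutator subgroup of the group $(B,+)$. For $x\in B$ let $\operatorname{Fix}^r(x)=\{b\in B: x\ast b=0\}$ (a subgroup of $(B,+)$), $\operatorname{Fix}^l(x)=\{b\in B: b\ast x=0\}$ (a subgroup of $(B,\circ)$), and let $C_x^+$, $C_x^\circ$ be the centralisers of $x$ in $(B,+)$ and $(B,\circ)$. $B$ has property (BS) if there is a positive integer $n$ such that $|(B,+):\operatorname{Fix}^r(x)\cap C_x^+|\le n$ and $|(B,\circ):\operatorname{Fix}^l(x)\cap C_x^\circ|\le n$ for all $x\in B$. *)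

theory Defs
  imports "HOL-Algebra.Algebra"
begin

text \<open>
  A skew brace is carried by a \<^const>\<open>carrier\<close>-based \<^typ>\<open>'a ring\<close> record, used only for its
  signature (no ring axiom is assumed): \<open>(B, +)\<close> is \<open>add_monoid B\<close>, with operations
  \<open>\<oplus>\<close>, \<open>\<ominus>\<close>, \<open>\<zero>\<close>, and \<open>(B, \<circ>)\<close> is the multiplicative structure of \<open>B\<close>, with operations
  \<open>\<otimes>\<close>, \<open>inv\<close>, \<open>\<one>\<close>. Neither group is assumed to be abelian. That the two identities coincide is
  proved below, not assumed.
\<close>

locale skew_brace =
  fixes B :: "('a, 'm) ring_scheme" (structure)
  assumes add_group: "group (add_monoid B)"
    and mult_group: "group B"
    and brace_distrib:
      "\<lbrakk>a \<in> carrier B; b \<in> carrier B; c \<in> carrier B\<rbrakk>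
        \<Longrightarrow> a \<otimes> (b \<oplus> c) = a \<otimes> b \<ominus> a \<oplus> a \<otimes> c"

definition brace_star :: "('a, 'm) ring_scheme \<Rightarrow> 'a \<Rightarrow> 'a \<Rightarrow> 'a" (infixl \<open>\<star>\<index>\<close> 70)
  where "a \<star>\<^bsub>B\<^esub> b = \<ominus>\<^bsub>B\<^esub> a \<oplus>\<^bsub>B\<^esub> a \<otimes>\<^bsub>B\<^esub> b \<ominus>\<^bsub>B\<^esub> b"

definition brace_square :: "('a, 'm) ring_scheme \<Rightarrow> 'a set"
  where "brace_square B =
    generate (add_monoid B) {a \<star>\<^bsub>B\<^esub> b | a b. a \<in> carrier B \<and> b \<in> carrier B}"

definition add_commutator :: "('a, 'm) ring_scheme \<Rightarrow> 'a set"
  where "add_commutator B = derived (add_monoid B) (carrier B)"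

definition Fix_r :: "('a, 'm) ring_scheme \<Rightarrow> 'a \<Rightarrow> 'a set"
  where "Fix_r B x = {b \<in> carrier B. x \<star>\<^bsub>B\<^esub> b = \<zero>\<^bsub>B\<^esub>}"

definition Fix_l :: "('a, 'm) ring_scheme \<Rightarrow> 'a \<Rightarrow> 'a set"
  where "Fix_l B x = {b \<in> carrier B. b \<star>\<^bsub>B\<^esub> x = \<zero>\<^bsub>B\<^esub>}"

definition centraliser :: "('a, 'm) monoid_scheme \<Rightarrow> 'a \<Rightarrow> 'a set"
  where "centraliser G x = {g \<in> carrier G. g \<otimes>\<^bsub>G\<^esub> x = x \<otimes>\<^bsub>G\<^esub> g}"

text \<open>\<open>|G : H| \<le> n\<close>. Finiteness is required explicitly since \<^const>\<open>card\<close> is \<open>0\<close> on infinite sets.\<close>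

definition index_le :: "('a, 'm) monoid_scheme \<Rightarrow> 'a set \<Rightarrow> nat \<Rightarrow> bool"
  where "index_le G H n \<longleftrightarrow> finite (rcosets\<^bsub>G\<^esub> H) \<and> card (rcosets\<^bsub>G\<^esub> H) \<le> n"

definition property_BS :: "('a, 'm) ring_scheme \<Rightarrow> bool"
  where "property_BS B \<longleftrightarrow> (\<exists>n::nat. n > 0 \<and> (\<forall>x\<in>carrier B.
    index_le (add_monoid B) (Fix_r B x \<inter> centraliser (add_monoid B) x) n \<and>
    index_le B (Fix_l B x \<inter> centraliser B x) n))"

lemma (in group) centraliser_subgroup:
  assumes x: "x \<in> carrier G"
  shows "subgroup (centraliser G x) G"
proof (rule subgroupI)
  show "centraliser G x \<subseteq> carrier G" by (auto simp: centraliser_def)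
  have "\<one> \<in> centraliser G x" using x by (simp add: centraliser_def)
  then show "centraliser G x \<noteq> {}" by blast
next
  fix a assume a: "a \<in> centraliser G x"
  then have c: "a \<in> carrier G" and e: "a \<otimes> x = x \<otimes> a" by (auto simp: centraliser_def)
  have "a \<otimes> (x \<otimes> inv a) = x" using c x e by (simp add: m_assoc[symmetric] inv_solve_right')
  then have "x \<otimes> inv a = inv a \<otimes> x" using c x by (simp add: inv_solve_left)
  then show "inv a \<in> centraliser G x" using c by (simp add: centraliser_def)
next
  fix a b assume "a \<in> centraliser G x" "b \<in> centraliser G x"
  then have c: "a \<in> carrier G" "b \<in> carrier G" and e: "a \<otimes> x = x \<otimes> a" "b \<otimes> x = x \<otimes> b"
    by (auto simp: centraliser_def)
  have "a \<otimes> b \<otimes> x = a \<otimes> x \<otimes> b" using c x by (simp add: e(2) m_assoc)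
  also have "\<dots> = x \<otimes> (a \<otimes> b)" using c x by (simp add: e m_assoc)
  finally show "a \<otimes> b \<in> centraliser G x" using c by (simp add: centraliser_def)
qed

context skew_brace
begin

interpretation A: group "add_monoid B"
  rewrites "carrier (add_monoid B) = carrier B"
    and "monoid.mult (add_monoid B) = (\<oplus>)"
    and "one (add_monoid B) = \<zero>"
    and "m_inv (add_monoid B) = a_inv B"
  by (rule add_group) (simp_all add: a_inv_def fun_eq_iff)

interpretation M: group B by (rule mult_group)

lemma mult_zero:
  assumes a: "a \<in> carrier B" shows "a \<otimes> \<zero> = a"
proof -
  have c: "a \<otimes> \<zero> \<in> carrier B" using a by simp
  have "a \<otimes> \<zero> \<oplus> \<zero> = a \<otimes> \<zero> \<oplus> (\<ominus> a \<oplus> a \<otimes> \<zero>)"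
    using brace_distrib[OF a A.one_closed A.one_closed] a c
    by (simp add: a_minus_def A.m_assoc)
  then have "\<zero> = \<ominus> a \<oplus> a \<otimes> \<zero>" using a c by (simp only: A.l_cancel A.one_closed A.m_closed A.inv_closed)
  then show ?thesis using a c A.inv_solve_left[of \<zero> a "a \<otimes> \<zero>"] by simp
qed

lemma one_eq_zero: "\<one> = \<zero>"
  using mult_zero[OF M.one_closed] by simp

lemma star_eq_zero_iff:
  assumes a: "a \<in> carrier B" and b: "b \<in> carrier B"
  shows "a \<star> b = \<zero> \<longleftrightarrow> a \<otimes> b = a \<oplus> b"
proof -
  have "a \<star> b = \<zero> \<longleftrightarrow> \<ominus> a \<oplus> a \<otimes> b = b"
    unfolding brace_star_def a_minus_def
    using A.inv_solve_right'[of \<zero> "\<ominus> a \<oplus> a \<otimes> b" b] a b by simp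
  also have "\<dots> \<longleftrightarrow> a \<otimes> b = a \<oplus> b"
    using A.inv_solve_left'[of b a "a \<otimes> b"] a b by simp
  finally show ?thesis .
qed

lemma Fix_r_subgroup:
  assumes x: "x \<in> carrier B"
  shows "subgroup (Fix_r B x) (add_monoid B)"
proof -
  have add: "x \<otimes> (b \<oplus> c) = x \<oplus> b \<oplus> (\<ominus> x \<oplus> x \<otimes> c)"
    if "b \<in> carrier B" "c \<in> carrier B" "x \<otimes> b = x \<oplus> b" for b c
    using brace_distrib[OF x that(1,2)] x that by (simp add: a_minus_def A.m_assoc)
  show ?thesis
  proof (rule group.subgroupI[OF add_group])
    show "Fix_r B x \<subseteq> carrier (add_monoid B)" by (auto simp: Fix_r_def)
    have "\<zero> \<in> Fix_r B x" using x by (simp add: Fix_r_def star_eq_zero_iff mult_zero)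
    then show "Fix_r B x \<noteq> {}" by blast
  next
    fix b assume "b \<in> Fix_r B x"
    then have b: "b \<in> carrier B" and e: "x \<otimes> b = x \<oplus> b"
      using x by (auto simp: Fix_r_def star_eq_zero_iff)
    have "x \<oplus> b \<oplus> (\<ominus> x \<oplus> x \<otimes> \<ominus> b) = x"
      using add[of b "\<ominus> b"] x b e by (simp add: mult_zero)
    then have "x \<oplus> (b \<oplus> (\<ominus> x \<oplus> x \<otimes> \<ominus> b)) = x \<oplus> \<zero>"
      using x b by (simp add: A.m_assoc)
    then have "b \<oplus> (\<ominus> x \<oplus> x \<otimes> \<ominus> b) = \<zero>"
      using x b by (simp only: A.l_cancel A.one_closed A.m_closed A.inv_closed M.m_closed)
    then have "\<ominus> x \<oplus> x \<otimes> \<ominus> b = \<ominus> b"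
      using x b A.inv_solve_left[of "\<ominus> x \<oplus> x \<otimes> \<ominus> b" b \<zero>] by simp
    then have "x \<otimes> \<ominus> b = x \<oplus> \<ominus> b"
      using A.inv_solve_left'[of "\<ominus> b" x "x \<otimes> \<ominus> b"] x b by simp
    then show "inv\<^bsub>add_monoid B\<^esub> b \<in> Fix_r B x"
      using x b by (simp add: Fix_r_def star_eq_zero_iff flip: a_inv_def)
  next
    fix b c assume "b \<in> Fix_r B x" "c \<in> Fix_r B x"
    then have b: "b \<in> carrier B" and c: "c \<in> carrier B"
      and e: "x \<otimes> b = x \<oplus> b" "x \<otimes> c = x \<oplus> c"
      using x by (auto simp: Fix_r_def star_eq_zero_iff)
    have "\<ominus> x \<oplus> (x \<oplus> c) = c"
      using A.inv_solve_left'[of c x "x \<oplus> c"] x c by simp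
    then have "x \<otimes> (b \<oplus> c) = x \<oplus> (b \<oplus> c)"
      using add[OF b c e(1)] x b c e(2) by (simp add: A.m_assoc)
    then show "b \<otimes>\<^bsub>add_monoid B\<^esub> c \<in> Fix_r B x"
      using x b c by (simp add: Fix_r_def star_eq_zero_iff)
  qed
qed

lemma Fix_l_subgroup:
  assumes x: "x \<in> carrier B"
  shows "subgroup (Fix_l B x) B"
proof (rule M.subgroupI)
  show "Fix_l B x \<subseteq> carrier B" by (auto simp: Fix_l_def)
  have "\<one> \<in> Fix_l B x"
    using x M.l_one[OF x] by (simp add: Fix_l_def star_eq_zero_iff one_eq_zero)
  then show "Fix_l B x \<noteq> {}" by blast
next
  fix b assume "b \<in> Fix_l B x"
  then have b: "b \<in> carrier B" and e: "b \<otimes> x = b \<oplus> x"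
    using x by (auto simp: Fix_l_def star_eq_zero_iff)
  have "inv b \<otimes> (b \<oplus> x) = x"
    using b x by (simp add: e[symmetric] M.m_assoc[symmetric])
  moreover have "inv b \<otimes> (b \<oplus> x) = \<ominus> (inv b) \<oplus> inv b \<otimes> x"
    using brace_distrib[of "inv b" b x] b x by (simp add: a_minus_def one_eq_zero)
  ultimately have "\<ominus> (inv b) \<oplus> inv b \<otimes> x = x" by simp
  then have "inv b \<otimes> x = inv b \<oplus> x"
    using A.inv_solve_left'[of x "inv b" "inv b \<otimes> x"] b x by simp
  then show "inv b \<in> Fix_l B x" using b x by (simp add: Fix_l_def star_eq_zero_iff)
next
  fix b c assume "b \<in> Fix_l B x" "c \<in> Fix_l B x"
  then have b: "b \<in> carrier B" and c: "c \<in> carrier B"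
    and e: "b \<otimes> x = b \<oplus> x" "c \<otimes> x = c \<oplus> x"
    using x by (auto simp: Fix_l_def star_eq_zero_iff)
  have "\<ominus> b \<oplus> (b \<oplus> x) = x"
    using A.inv_solve_left'[of x b "b \<oplus> x"] b x by simp
  then have "b \<otimes> c \<otimes> x = b \<otimes> c \<oplus> x"
    using brace_distrib[OF b c x] b c x
    by (simp add: M.m_assoc e a_minus_def A.m_assoc)
  then show "b \<otimes> c \<in> Fix_l B x" using b c x by (simp add: Fix_l_def star_eq_zero_iff)
qed

end

end

theory Submission
  imports Defs
begin

text \<open>
  Let \<open>\<lambda>\<^sub>x(b) = -x + x \<circ> b\<close>, so that \<open>x * b = \<lambda>\<^sub>x(b) - b\<close> and \<open>\<lambda>\<close> is an action of \<open>(B, \<circ>)\<close> on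
  \<open>(B, +)\<close> by automorphisms. The key object is the semidirect product \<open>G = (B, +) \<rtimes> (B, \<circ>)\<close> for this
  action: both \<open>x * b\<close> and the additive commutators are, in the first coordinate, commutators of
  \<open>G\<close>, so \<open>B\<^sup>(\<^sup>2\<^sup>)\<close> and \<open>[B, B]\<^sub>+\<close> embed into the derived subgroup of \<open>G\<close>.

  Assume (BS) with bound \<open>n\<close>. The four subgroups in (BS) consist of the elements of one factor of
  \<open>G\<close> that commute with \<open>x\<close>, where \<open>x\<close> is taken in either factor. So the conjugacy classes of both
  groups, the \<open>\<lambda>\<close>-orbits, and the sets \<open>{b - \<lambda>\<^sub>x(b) | b \<in> B}\<close> all have at most \<open>n\<close> elements.
  The conjugate of \<open>(a, x)\<close> by \<open>(b, y)\<close> is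
  \<open>((b + \<lambda>\<^sub>y(a) - b) + (b - \<lambda>\<^sub>z(b)), z)\<close> with \<open>z = y \<circ> x \<circ> y\<^sup>-\<^sup>1\<close>, which leaves at most \<open>n\<^sup>4\<close> possibilities
  (\<open>conj_class_semidirect_subset\<close>). By B. H. Neumann's theorem a group whose conjugacy classes have
  bounded size has a finite derived subgroup, and hence \<open>B\<^sup>(\<^sup>2\<^sup>)\<close> and \<open>[B, B]\<^sub>+\<close> are finite.

  Neumann's theorem is proved in two steps. A conjugacy class of maximal size controls the
  commutators \<open>[u, y]\<close> with \<open>u\<close> in a subgroup of finite index, so that there are only finitely many
  commutators (\<open>finite_commutators_if_bounded_classes\<close>). Then a high power of a commutator is a
  product of fewer commutators (\<open>pow_commutator_shorten\<close>), so long products of commutators can be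
  shortened, and finitely many commutators generate a finite group
  (\<open>finite_derived_if_finite_commutators\<close>).

  Conversely, let \<open>B\<^sup>(\<^sup>2\<^sup>)\<close> and \<open>[B, B]\<^sub>+\<close> be finite. Cosets of the subgroups in (BS) are separated by
  the values \<open>x * (-b)\<close> and \<open>[-b, x]\<^sub>+\<close>, respectively by the images of \<open>x\<close> under \<open>\<lambda>\<close> and under
  conjugation in \<open>(B, \<circ>)\<close>. For the last of these, \<open>y = b \<circ> x \<circ> b\<^sup>-\<^sup>1\<close> satisfies \<open>y \<circ> b = b \<circ> x\<close>, that
  is, \<open>y + y * b + b = b + b * x + x\<close>, and so \<open>y = c + s + x - t\<close> with \<open>c\<close> an additive commutator and
  \<open>s, t \<in> B\<^sup>(\<^sup>2\<^sup>)\<close>. All these values lie in finite sets whose size does not depend on \<open>x\<close>.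
\<close>

section \<open>Sets of bounded size\<close>

text \<open>
  Finiteness is a separate conjunct, as in \<open>index_le\<close>, because \<^const>\<open>card\<close> is \<open>0\<close> on infinite sets.
\<close>

definition size_le :: "'a set \<Rightarrow> nat \<Rightarrow> bool"
  where "size_le S n \<longleftrightarrow> finite S \<and> card S \<le> n"

lemma size_le_subset: "size_le T n \<Longrightarrow> S \<subseteq> T \<Longrightarrow> size_le S n"
  unfolding size_le_def by (meson card_mono finite_subset order_trans)

lemma size_le_image: "size_le S n \<Longrightarrow> size_le (f ` S) n"
  unfolding size_le_def by (meson card_image_le finite_imageI order_trans)

lemma size_le_Times: "size_le S m \<Longrightarrow> size_le T n \<Longrightarrow> size_le (S \<times> T) (m * n)"
  unfolding size_le_def by (simp add: card_cartesian_product mult_le_mono)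

lemma size_le_UN:
  assumes "size_le I m" "\<And>i. i \<in> I \<Longrightarrow> size_le (S i) n"
  shows "size_le (\<Union>i\<in>I. S i) (m * n)"
proof -
  have "card (\<Union>i\<in>I. S i) \<le> (\<Sum>i\<in>I. card (S i))"
    using assms by (intro card_UN_le) (simp add: size_le_def)
  also have "\<dots> \<le> card I * n"
    using sum_bounded_above[of I "\<lambda>i. card (S i)" n] assms by (simp add: size_le_def)
  also have "\<dots> \<le> m * n" using assms by (simp add: size_le_def)
  finally show ?thesis using assms by (simp add: size_le_def)
qed

section \<open>Groups with conjugacy classes of bounded size\<close>

definition conj_class :: "('a, 'm) monoid_scheme \<Rightarrow> 'a \<Rightarrow> 'a set"
  where "conj_class G x = (\<lambda>g. g \<otimes>\<^bsub>G\<^esub> x \<otimes>\<^bsub>G\<^esub> inv\<^bsub>G\<^esub> g) ` carrier G"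

context group
begin

lemma inv_mult_cancel:
  assumes "a \<in> carrier G" "b \<in> carrier G"
  shows "inv a \<otimes> (a \<otimes> b) = b" "a \<otimes> (inv a \<otimes> b) = b"
  using assms by (simp_all flip: m_assoc)

text \<open>
  Since all elements of \<open>T\<close> have only finitely many conjugates, an element \<open>g\<close> can act on \<open>T\<close> by
  conjugation in only finitely many ways. In other words, \<open>R\<close> meets every left coset of the common
  centraliser of \<open>T\<close>.
\<close>

lemma finite_conj_representatives:
  assumes "finite T" "\<And>t. t \<in> T \<Longrightarrow> finite (conj_class G t)"
  obtains R where "finite R" "R \<subseteq> carrier G"
    "\<And>g. g \<in> carrier G \<Longrightarrow> \<exists>r\<in>R. \<forall>t\<in>T. r \<otimes> t \<otimes> inv r = g \<otimes> t \<otimes> inv g"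
proof -
  let ?f = "\<lambda>g. \<lambda>t\<in>T. g \<otimes> t \<otimes> inv g"
  have "?f ` carrier G \<subseteq> PiE T (conj_class G)"
    by (auto simp: conj_class_def)
  then have "finite (?f ` carrier G)"
    by (rule finite_subset) (intro finite_PiE assms)
  then obtain R where R: "R \<subseteq> carrier G" "finite R" "?f ` carrier G = ?f ` R"
    using finite_subset_image[of "?f ` carrier G" ?f "carrier G"] by auto
  have "\<exists>r\<in>R. \<forall>t\<in>T. r \<otimes> t \<otimes> inv r = g \<otimes> t \<otimes> inv g" if "g \<in> carrier G" for g
  proof -
    have "?f g \<in> ?f ` R" using R(3) that by blast
    then obtain r where r: "r \<in> R" "?f g = ?f r" by blast
    have "r \<otimes> t \<otimes> inv r = g \<otimes> t \<otimes> inv g" if "t \<in> T" for t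
      using fun_cong[OF r(2), of t] that by simp
    then show ?thesis using r(1) by blast
  qed
  then show thesis using that R by blast
qed

text \<open>
  Let \<open>K\<close> be a conjugacy class of maximal size, the class of \<open>a\<close> say, and let the finite set \<open>T\<close>
  contain a conjugating element for every member of \<open>K\<close>. If \<open>v\<close> centralises \<open>T\<close>, then the class of
  \<open>v a\<close> contains \<open>v K\<close> and, by maximality, is equal to it. Hence for every \<open>y\<close> the conjugate
  \<open>y v a y\<^sup>-\<^sup>1\<close> is \<open>v k\<close> with \<open>k \<in> K\<close>, and \<open>v\<^sup>-\<^sup>1 y v y\<^sup>-\<^sup>1 = k (y a y\<^sup>-\<^sup>1)\<^sup>-\<^sup>1\<close> lies in the finite set
  \<open>K K\<^sup>-\<^sup>1\<close>. An arbitrary element is \<open>r u\<close> with \<open>u\<close> centralising \<open>T\<close> and \<open>r\<close> one of finitely many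
  representatives, and \<open>[r u, y] = r [u, y] r\<^sup>-\<^sup>1 [r, y]\<close>.
\<close>

lemma finite_commutators_if_bounded_classes:
  assumes size: "\<And>x. x \<in> carrier G \<Longrightarrow> size_le (conj_class G x) n"
  shows "finite (derived_set G (carrier G))"
proof -
  have fin: "finite (conj_class G x)" and bound: "card (conj_class G x) \<le> n"
    if "x \<in> carrier G" for x
    using size[OF that] by (simp_all add: size_le_def)
  obtain a where a: "a \<in> carrier G"
    and max: "\<And>x. x \<in> carrier G \<Longrightarrow> card (conj_class G x) \<le> card (conj_class G a)"
    using ex_has_greatest_nat[of "\<lambda>x. x \<in> carrier G" \<one> "\<lambda>x. card (conj_class G x)" "Suc n"]
      bound by (force simp: less_Suc_eq_le)
  let ?K = "conj_class G a"
  have K: "?K \<subseteq> carrier G" using a by (auto simp: conj_class_def)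
  obtain T where T: "T \<subseteq> carrier G" "finite T" "?K = (\<lambda>g. g \<otimes> a \<otimes> inv g) ` T"
    using finite_subset_image[of ?K "\<lambda>g. g \<otimes> a \<otimes> inv g" "carrier G"] fin[OF a]
    by (auto simp: conj_class_def)
  define F where "F = (\<lambda>(k, l). k \<otimes> inv l) ` (?K \<times> ?K)"
  have F: "finite F" "F \<subseteq> carrier G" using fin[OF a] K by (auto simp: F_def)
  have in_F: "u \<otimes> y \<otimes> inv u \<otimes> inv y \<in> F"
    if u: "u \<in> carrier G" and y: "y \<in> carrier G" and cent: "\<And>t. t \<in> T \<Longrightarrow> t \<otimes> u = u \<otimes> t" for u y
  proof -
    define v where "v = inv u"
    have v: "v \<in> carrier G" using u v_def by simp
    have centv: "t \<otimes> v = v \<otimes> t" if "t \<in> T" for t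
    proof -
      have t: "t \<in> carrier G" using T that by blast
      have "v \<otimes> (t \<otimes> u) \<otimes> v = v \<otimes> (u \<otimes> t) \<otimes> v" using cent[OF that] by simp
      then show ?thesis using t u by (simp add: v_def m_assoc inv_mult_cancel)
    qed
    \<comment> \<open>A conjugating element \<open>t \<in> T\<close> commutes with \<open>v\<close>, so it takes \<open>v a\<close> to \<open>v (t a t\<^sup>-\<^sup>1)\<close>.\<close>
    have "(\<lambda>k. v \<otimes> k) ` ?K \<subseteq> conj_class G (v \<otimes> a)"
    proof
      fix z assume "z \<in> (\<lambda>k. v \<otimes> k) ` ?K"
      then obtain t where t: "t \<in> T" "z = v \<otimes> (t \<otimes> a \<otimes> inv t)" using T(3) by auto
      have tc: "t \<in> carrier G" using t T by blast
      have "z = v \<otimes> t \<otimes> a \<otimes> inv t" using t tc v a by (simp add: m_assoc)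
      also have "\<dots> = t \<otimes> (v \<otimes> a) \<otimes> inv t" using t tc v a by (simp add: m_assoc flip: centv)
      finally show "z \<in> conj_class G (v \<otimes> a)" using tc by (auto simp: conj_class_def)
    qed
    moreover have "card ((\<lambda>k. v \<otimes> k) ` ?K) = card ?K"
      by (rule card_image, rule inj_onI) (meson K v l_cancel subsetD)
    ultimately have eq: "(\<lambda>k. v \<otimes> k) ` ?K = conj_class G (v \<otimes> a)"
      using card_seteq[OF fin] max v a by (metis m_closed)
    have "y \<otimes> (v \<otimes> a) \<otimes> inv y \<in> conj_class G (v \<otimes> a)" using y by (auto simp: conj_class_def)
    then obtain k where k: "k \<in> ?K" "y \<otimes> (v \<otimes> a) \<otimes> inv y = v \<otimes> k" using eq by auto
    let ?l = "y \<otimes> a \<otimes> inv y"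
    have l: "?l \<in> ?K" using y by (auto simp: conj_class_def)
    have kc: "k \<in> carrier G" using k K by blast
    have "k = u \<otimes> (v \<otimes> k)" using u kc by (simp add: v_def inv_mult_cancel)
    also have "\<dots> = u \<otimes> (y \<otimes> (v \<otimes> a) \<otimes> inv y)" using k by simp
    finally have "u \<otimes> y \<otimes> inv u \<otimes> inv y = k \<otimes> inv ?l"
      using u y a by (simp add: v_def m_assoc inv_mult_group inv_mult_cancel)
    then show ?thesis using k l by (auto simp: F_def)
  qed
  obtain R where R: "finite R" "R \<subseteq> carrier G"
    and rep: "\<And>g. g \<in> carrier G \<Longrightarrow> \<exists>r\<in>R. \<forall>t\<in>T. r \<otimes> t \<otimes> inv r = g \<otimes> t \<otimes> inv g"
    using finite_conj_representatives[OF T(2) fin] T(1) by blast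
  let ?S = "\<Union>r\<in>R. (\<lambda>(f, k). r \<otimes> f \<otimes> inv r \<otimes> (r \<otimes> inv k)) ` (F \<times> conj_class G r)"
  have "g \<otimes> y \<otimes> inv g \<otimes> inv y \<in> ?S" if g: "g \<in> carrier G" and y: "y \<in> carrier G" for g y
  proof -
    obtain r where r: "r \<in> R" and rt: "\<And>t. t \<in> T \<Longrightarrow> r \<otimes> t \<otimes> inv r = g \<otimes> t \<otimes> inv g"
      using rep[OF g] by blast
    have rc: "r \<in> carrier G" using r R by blast
    define u where "u = inv r \<otimes> g"
    have u: "u \<in> carrier G" using rc g by (simp add: u_def)
    have "t \<otimes> u = u \<otimes> t" if "t \<in> T" for t
    proof -
      have t: "t \<in> carrier G" using T that by blast
      have "inv r \<otimes> (r \<otimes> t \<otimes> inv r) \<otimes> g = inv r \<otimes> (g \<otimes> t \<otimes> inv g) \<otimes> g"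
        using rt[OF that] by simp
      then show ?thesis using t rc g by (simp add: u_def m_assoc inv_mult_cancel)
    qed
    then have "u \<otimes> y \<otimes> inv u \<otimes> inv y \<in> F" by (rule in_F[OF u y])
    moreover have "y \<otimes> r \<otimes> inv y \<in> conj_class G r" using y by (auto simp: conj_class_def)
    moreover have "g \<otimes> y \<otimes> inv g \<otimes> inv y =
        r \<otimes> (u \<otimes> y \<otimes> inv u \<otimes> inv y) \<otimes> inv r \<otimes> (r \<otimes> inv (y \<otimes> r \<otimes> inv y))"
      using rc g y by (simp add: u_def m_assoc inv_mult_group inv_mult_cancel)
    ultimately show ?thesis using r by (intro UN_I[of r]) force+
  qed
  then have "derived_set G (carrier G) \<subseteq> ?S" by blast
  moreover have "finite ?S" using R F fin by auto
  ultimately show ?thesis by (rule finite_subset)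
qed

definition list_mult :: "'a list \<Rightarrow> 'a"
  where "list_mult xs = foldr (\<otimes>) xs \<one>"

lemma list_mult_simps [simp]:
  "list_mult [] = \<one>" "list_mult (x # xs) = x \<otimes> list_mult xs"
  by (simp_all add: list_mult_def)

lemma list_mult_closed [simp]: "set xs \<subseteq> carrier G \<Longrightarrow> list_mult xs \<in> carrier G"
  by (induction xs) auto

lemma list_mult_append:
  "set xs \<subseteq> carrier G \<Longrightarrow> set ys \<subseteq> carrier G \<Longrightarrow> list_mult (xs @ ys) = list_mult xs \<otimes> list_mult ys"
  by (induction xs) (auto simp: m_assoc)

text \<open>
  In a product of elements of a conjugation-invariant set, occurrences of \<open>c\<close> can be moved to the
  front: the factors that they pass are replaced by conjugates, and the length does not change.
\<close>

lemma list_mult_collect: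
  assumes S: "S \<subseteq> carrier G"
    and normal: "\<And>g x. g \<in> carrier G \<Longrightarrow> x \<in> S \<Longrightarrow> inv g \<otimes> x \<otimes> g \<in> S"
    and c: "c \<in> S"
  shows "set xs \<subseteq> S \<Longrightarrow> m \<le> count_list xs c \<Longrightarrow>
    \<exists>ys. set ys \<subseteq> S \<and> length ys + m = length xs \<and> list_mult xs = c [^] m \<otimes> list_mult ys"
proof (induction xs arbitrary: m)
  case Nil
  then show ?case by simp
next
  case (Cons x xs)
  have cc: "c \<in> carrier G" and xS: "x \<in> S" and xc: "x \<in> carrier G" using S c Cons.prems by auto
  show ?case
  proof (cases "x = c \<and> m > 0")
    case True
    then obtain k where k: "m = Suc k" by (cases m) auto
    have "k \<le> count_list xs c" using Cons.prems True k by simp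
    then obtain ys where ys: "set ys \<subseteq> S" "length ys + k = length xs"
        "list_mult xs = c [^] k \<otimes> list_mult ys"
      using Cons.IH[of k] Cons.prems by auto
    have "list_mult ys \<in> carrier G" using ys S by auto
    then have "list_mult (x # xs) = c [^] m \<otimes> list_mult ys"
      using True ys cc k nat_pow_Suc2[OF cc, of k] by (simp add: m_assoc del: nat_pow_Suc)
    then show ?thesis using ys k by (intro exI[of _ ys]) simp
  next
    case False
    then have "m \<le> count_list xs c" using Cons.prems by (auto split: if_splits)
    then obtain ys where ys: "set ys \<subseteq> S" "length ys + m = length xs"
        "list_mult xs = c [^] m \<otimes> list_mult ys"
      using Cons.IH[of m] Cons.prems by auto
    let ?x = "inv (c [^] m) \<otimes> x \<otimes> c [^] m"
    have "list_mult ys \<in> carrier G" using ys S by auto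
    then have "list_mult (x # xs) = c [^] m \<otimes> list_mult (?x # ys)"
      using ys cc xc by (simp add: m_assoc inv_mult_cancel)
    moreover have "?x \<in> S" using normal[of "c [^] m" x] cc xS by simp
    ultimately show ?thesis using ys by (intro exI[of _ "?x # ys"]) simp
  qed
qed

text \<open>
  For \<open>c = a b a\<^sup>-\<^sup>1 b\<^sup>-\<^sup>1\<close> such that \<open>c\<^sup>k\<^sup>+\<^sup>1\<close> commutes with \<open>b\<close>, the last \<open>b\<^sup>-\<^sup>1\<close> of the first factor of
  \<open>c\<^sup>k\<^sup>+\<^sup>2 = a b a\<^sup>-\<^sup>1 b\<^sup>-\<^sup>1 c\<^sup>k\<^sup>+\<^sup>1\<close> can be moved to the far right. Expanding one more factor \<open>c\<close> gives
  \<open>a b\<^sup>2 a\<^sup>-\<^sup>1 b\<^sup>-\<^sup>1 c\<^sup>k b\<^sup>-\<^sup>1 = [a, b\<^sup>2] (b c\<^sup>k b\<^sup>-\<^sup>1)\<close>. Since conjugates of commutators are commutators, the right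
  hand side is a product of \<open>k + 1\<close> commutators, one fewer than on the left.
\<close>

lemma pow_commutator_shorten:
  assumes a: "a \<in> carrier G" and b: "b \<in> carrier G"
    and c: "c = a \<otimes> b \<otimes> inv a \<otimes> inv b" and comm: "c [^] Suc k \<otimes> b = b \<otimes> c [^] Suc k"
  shows "c [^] Suc (Suc k) =
    (a \<otimes> (b \<otimes> b) \<otimes> inv a \<otimes> inv (b \<otimes> b)) \<otimes> (b \<otimes> c \<otimes> inv b) [^] k"
proof -
  have cc: "c \<in> carrier G" using a b c by simp
  have conj_pow: "(b \<otimes> c \<otimes> inv b) [^] i = b \<otimes> c [^] i \<otimes> inv b" for i :: nat
    by (induction i) (use b cc in \<open>simp_all add: m_assoc inv_mult_cancel\<close>)
  have "inv b \<otimes> (c [^] Suc k \<otimes> b) \<otimes> inv b = inv b \<otimes> (b \<otimes> c [^] Suc k) \<otimes> inv b"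
    using comm by simp
  then have comm': "inv b \<otimes> c [^] Suc k = c [^] Suc k \<otimes> inv b"
    using b cc by (simp add: m_assoc inv_mult_cancel)
  have "c [^] Suc (Suc k) = c \<otimes> c [^] Suc k" using cc by (rule nat_pow_Suc2)
  also have "\<dots> = a \<otimes> b \<otimes> inv a \<otimes> (inv b \<otimes> c [^] Suc k)" using a b cc by (subst c) (simp add: m_assoc)
  also have "\<dots> = a \<otimes> b \<otimes> inv a \<otimes> ((c \<otimes> c [^] k) \<otimes> inv b)"
    using comm' nat_pow_Suc2[OF cc, of k] by simp
  also have "\<dots> = a \<otimes> b \<otimes> inv a \<otimes> c \<otimes> (c [^] k \<otimes> inv b)"
    using a b cc by (simp add: m_assoc)
  also have "\<dots> = a \<otimes> b \<otimes> inv a \<otimes> (a \<otimes> b \<otimes> inv a \<otimes> inv b) \<otimes> (c [^] k \<otimes> inv b)"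
    by (simp only: flip: c)
  also have "\<dots> = (a \<otimes> (b \<otimes> b) \<otimes> inv a \<otimes> inv (b \<otimes> b)) \<otimes> (b \<otimes> c [^] k \<otimes> inv b)"
    using a b cc by (simp add: m_assoc inv_mult_cancel inv_mult_group)
  finally show ?thesis by (simp only: conj_pow)
qed

text \<open>
  For each commutator \<open>c = [a, b]\<close> only finitely many values \<open>[c\<^sup>i, b]\<close> occur, so a positive power of
  \<open>c\<close> commutes with \<open>b\<close> and some power \<open>c\<^sup>K\<^sup>+\<^sup>2\<close> is a product of \<open>K + 1\<close> commutators. If a product of
  commutators is longer than the sum of all \<open>K + 1\<close>, then by the pigeonhole principle one commutator
  occurs in it at least \<open>K + 2\<close> times; collecting these occurrences shortens the product. Therefore
  every element of the derived subgroup is a product of boundedly many of the finitely many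
  commutators.
\<close>

lemma finite_derived_if_finite_commutators:
  assumes fin: "finite (derived_set G (carrier G))"
  shows "finite (derived G (carrier G))"
proof -
  define S where "S = derived_set G (carrier G)"
  have S: "S \<subseteq> carrier G" by (auto simp: S_def)
  have finS: "finite S" using fin S_def by simp
  have comm_in: "a \<otimes> b \<otimes> inv a \<otimes> inv b \<in> S" if "a \<in> carrier G" "b \<in> carrier G" for a b
    using that by (auto simp: S_def)
  have normal: "inv g \<otimes> x \<otimes> g \<in> S" if g: "g \<in> carrier G" and "x \<in> S" for g x
  proof -
    obtain a b where ab: "a \<in> carrier G" "b \<in> carrier G" "x = a \<otimes> b \<otimes> inv a \<otimes> inv b"
      using \<open>x \<in> S\<close> by (auto simp: S_def)
    have "inv g \<otimes> x \<otimes> g = (inv g \<otimes> a \<otimes> g) \<otimes> (inv g \<otimes> b \<otimes> g) \<otimes> inv (inv g \<otimes> a \<otimes> g) \<otimes> inv (inv g \<otimes> b \<otimes> g)"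
      using ab g by (simp add: m_assoc inv_mult_cancel inv_mult_group)
    then show ?thesis using comm_in[of "inv g \<otimes> a \<otimes> g" "inv g \<otimes> b \<otimes> g"] ab g by simp
  qed
  have inv_in: "inv x \<in> S" if "x \<in> S" for x
  proof -
    obtain a b where ab: "a \<in> carrier G" "b \<in> carrier G" "x = a \<otimes> b \<otimes> inv a \<otimes> inv b"
      using \<open>x \<in> S\<close> by (auto simp: S_def)
    then have "inv x = b \<otimes> a \<otimes> inv b \<otimes> inv a" by (simp add: m_assoc inv_mult_group)
    then show ?thesis using comm_in ab by simp
  qed
  have "\<exists>k. \<exists>ys. set ys \<subseteq> S \<and> length ys = Suc k \<and> c [^] Suc (Suc k) = list_mult ys" if "c \<in> S" for c
  proof -
    obtain a b where ab: "a \<in> carrier G" "b \<in> carrier G" "c = a \<otimes> b \<otimes> inv a \<otimes> inv b"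
      using \<open>c \<in> S\<close> by (auto simp: S_def)
    have cc: "c \<in> carrier G" using that S by blast
    \<comment> \<open>Two equal values of \<open>[c\<^sup>i, b]\<close> yield a power of \<open>c\<close> that commutes with \<open>b\<close>.\<close>
    define f where "f = (\<lambda>i::nat. c [^] i \<otimes> b \<otimes> inv (c [^] i) \<otimes> inv b)"
    have "range f \<subseteq> S" using comm_in ab cc by (auto simp: f_def)
    then have "\<not> inj f" using finS finite_subset range_inj_infinite by blast
    then obtain i j where ij: "i < j" "f i = f j" unfolding inj_def by (metis nat_neq_iff)
    then obtain k where k: "j = i + Suc k" using less_imp_Suc_add by fastforce
    have split: "c [^] j = c [^] i \<otimes> c [^] Suc k" using k nat_pow_mult[OF cc, of i "Suc k"] by simp
    define p where "p = c [^] i"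
    define q where "q = c [^] Suc k"
    have pq: "p \<in> carrier G" "q \<in> carrier G" using cc by (simp_all add: p_def q_def)
    have "p \<otimes> b \<otimes> inv p \<otimes> inv b = p \<otimes> q \<otimes> b \<otimes> inv (p \<otimes> q) \<otimes> inv b"
      using ij(2) by (simp only: f_def split p_def q_def)
    then have "inv p \<otimes> (p \<otimes> b \<otimes> inv p \<otimes> inv b) \<otimes> b \<otimes> p \<otimes> q
        = inv p \<otimes> (p \<otimes> q \<otimes> b \<otimes> inv (p \<otimes> q) \<otimes> inv b) \<otimes> b \<otimes> p \<otimes> q" by simp
    then have "c [^] Suc k \<otimes> b = b \<otimes> c [^] Suc k"
      using pq ab unfolding q_def[symmetric] by (simp add: m_assoc inv_mult_cancel inv_mult_group)
    note short = pow_commutator_shorten[OF ab this]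
    have "inv (inv b) \<otimes> c \<otimes> inv b \<in> S" using normal[of "inv b" c] ab that by simp
    then have conjS: "b \<otimes> c \<otimes> inv b \<in> S" using ab by simp
    have rep: "list_mult (replicate m x) = x [^] m" if "x \<in> carrier G" for m x
      by (induction m) (use that nat_pow_Suc2 in auto)
    let ?ys = "(a \<otimes> (b \<otimes> b) \<otimes> inv a \<otimes> inv (b \<otimes> b)) # replicate k (b \<otimes> c \<otimes> inv b)"
    have "c [^] Suc (Suc k) = list_mult ?ys" using short rep[of "b \<otimes> c \<otimes> inv b" k] conjS S by auto
    moreover have "set ?ys \<subseteq> S" using conjS comm_in[of a "b \<otimes> b"] ab by auto
    ultimately show ?thesis by (intro exI[of _ k] exI[of _ ?ys]) simp
  qed
  then obtain K where K: "\<And>c. c \<in> S \<Longrightarrow>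
      \<exists>ys. set ys \<subseteq> S \<and> length ys = Suc (K c) \<and> c [^] Suc (Suc (K c)) = list_mult ys" by metis
  define N where "N = (\<Sum>c\<in>S. Suc (K c))"
  define P where "P = list_mult ` {xs. set xs \<subseteq> S \<and> length xs \<le> N}"
  have short: "list_mult xs \<in> P" if "set xs \<subseteq> S" for xs
    using that
  proof (induction "length xs" arbitrary: xs rule: less_induct)
    case less
    show ?case
    proof (cases "length xs \<le> N")
      case True
      then show ?thesis using less.prems by (auto simp: P_def)
    next
      case False
      have "\<exists>c\<in>S. Suc (K c) < count_list xs c"
      proof (rule ccontr)
        assume "\<not> ?thesis"
        then have "(\<Sum>c\<in>S. count_list xs c) \<le> N" unfolding N_def by (intro sum_mono) auto
        then show False using False sum_count_set[OF less.prems finS] by simp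
      qed
      then obtain c where c: "c \<in> S" "Suc (Suc (K c)) \<le> count_list xs c" by auto
      obtain ys where ys: "set ys \<subseteq> S" "length ys + Suc (Suc (K c)) = length xs"
          "list_mult xs = c [^] Suc (Suc (K c)) \<otimes> list_mult ys"
        using list_mult_collect[OF S normal c(1) less.prems c(2)] by blast
      obtain zs where zs: "set zs \<subseteq> S" "length zs = Suc (K c)" "c [^] Suc (Suc (K c)) = list_mult zs"
        using K[OF c(1)] by blast
      have "list_mult xs = list_mult (zs @ ys)"
        using ys zs S list_mult_append[of zs ys] by auto
      moreover have "list_mult (zs @ ys) \<in> P" using less.hyps[of "zs @ ys"] ys zs by auto
      ultimately show ?thesis by simp
    qed
  qed
  have "\<exists>xs. set xs \<subseteq> S \<and> g = list_mult xs" if "g \<in> generate G S" for g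
    using that
  proof induction
    case one
    then show ?case by (intro exI[of _ "[]"]) simp
  next
    case (incl h)
    then show ?case using S by (intro exI[of _ "[h]"]) auto
  next
    case (inv h)
    then show ?case using S inv_in by (intro exI[of _ "[inv h]"]) auto
  next
    case (eng g h)
    then obtain xs ys where "set xs \<subseteq> S" "g = list_mult xs" "set ys \<subseteq> S" "h = list_mult ys" by blast
    then show ?case using S list_mult_append[of xs ys] by (intro exI[of _ "xs @ ys"]) auto
  qed
  then have "generate G S \<subseteq> P" using short by blast
  moreover have "finite P" unfolding P_def using finite_lists_length_le[OF finS] by simp
  ultimately show ?thesis unfolding derived_def S_def[symmetric] using finite_subset by blast
qed

end

section \<open>Indices of stabilisers\<close>

context group
begin

lemma commutator_in_derived:
  assumes "a \<in> carrier G" "b \<in> carrier G"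
  shows "a \<otimes> b \<otimes> inv a \<otimes> inv b \<in> derived G (carrier G)"
  unfolding derived_def using assms by (intro generate.incl) blast

text \<open>
  The index is counted with right cosets \<open>H g\<close>, whereas left actions \<open>g \<mapsto> g \<cdot> x\<close> are constant on the left
  cosets of the stabiliser of \<open>x\<close>. Replacing \<open>g\<close> by its inverse passes from one to the other without
  changing the orbit.
\<close>

lemma image_inv_reparam: "(\<lambda>g. f (inv g)) ` carrier G = f ` carrier G"
proof
  show "f ` carrier G \<subseteq> (\<lambda>g. f (inv g)) ` carrier G"
  proof
    fix z assume "z \<in> f ` carrier G"
    then obtain g where "g \<in> carrier G" "z = f (inv (inv g))" by auto
    then show "z \<in> (\<lambda>g. f (inv g)) ` carrier G" by blast
  qed
qed auto

lemma size_le_image_if_index_le: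
  assumes H: "subgroup H G" and ind: "index_le G H n"
    and const: "\<And>h g. h \<in> H \<Longrightarrow> g \<in> carrier G \<Longrightarrow> f (h \<otimes> g) = f g"
  shows "size_le (f ` carrier G) n"
proof (rule size_le_subset)
  show "size_le ((\<lambda>C. f (SOME g. g \<in> C)) ` (rcosets H)) n"
    using ind by (intro size_le_image) (simp add: size_le_def index_le_def)
  show "f ` carrier G \<subseteq> (\<lambda>C. f (SOME g. g \<in> C)) ` (rcosets H)"
  proof
    fix z assume "z \<in> f ` carrier G"
    then obtain g where g: "g \<in> carrier G" "z = f g" by blast
    have "g \<in> H #> g" using rcos_self[OF g(1) H] .
    then have "(SOME k. k \<in> H #> g) \<in> H #> g" by (rule someI)
    then have "f (SOME k. k \<in> H #> g) = f g" using const g by (auto simp: r_coset_def)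
    then show "z \<in> (\<lambda>C. f (SOME g. g \<in> C)) ` (rcosets H)"
      using g rcosetsI[OF subgroup.subset[OF H] g(1)] by (metis imageI)
  qed
qed

lemma index_le_if_separated:
  assumes H: "subgroup H G" and V: "f ` carrier G \<subseteq> V" "size_le V n"
    and sep: "\<And>g k. g \<in> carrier G \<Longrightarrow> k \<in> carrier G \<Longrightarrow> f g = f k \<Longrightarrow> g \<otimes> inv k \<in> H"
  shows "index_le G H n"
proof -
  let ?c = "\<lambda>v. H #> (SOME g. g \<in> carrier G \<and> f g = v)"
  have "rcosets H \<subseteq> ?c ` V"
  proof
    fix C assume "C \<in> rcosets H"
    then obtain g where g: "g \<in> carrier G" "C = H #> g" by (auto simp: RCOSETS_def)
    define k where "k = (SOME k. k \<in> carrier G \<and> f k = f g)"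
    have "k \<in> carrier G \<and> f k = f g" unfolding k_def by (rule someI[of _ g]) (use g in simp)
    then have k: "k \<in> carrier G" "g \<otimes> inv k \<in> H" using sep[OF g(1), of k] by auto
    then have "g \<in> H #> k"
      using g by (auto simp: r_coset_def m_assoc intro!: bexI[of _ "g \<otimes> inv k"])
    then have "C = ?c (f g)" using repr_independence[OF _ k(1) H] g k_def by simp
    then show "C \<in> ?c ` V" using V g by blast
  qed
  then have "size_le (rcosets H) n" by (rule size_le_subset[OF size_le_image[OF V(2)]])
  then show ?thesis by (simp add: index_le_def size_le_def)
qed

lemma conj_class_size_le:
  assumes x: "x \<in> carrier G" and H: "subgroup H G" "H \<subseteq> centraliser G x" and ind: "index_le G H n"
  shows "size_le (conj_class G x) n"
proof -
  have "size_le ((\<lambda>g. inv g \<otimes> x \<otimes> g) ` carrier G) n"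
  proof (rule size_le_image_if_index_le[OF H(1) ind])
    fix h g assume h: "h \<in> H" and g: "g \<in> carrier G"
    have hc: "h \<in> carrier G" and "h \<otimes> x = x \<otimes> h" using h H by (auto simp: centraliser_def)
    then have "inv h \<otimes> x \<otimes> h = x" using x by (simp add: m_assoc inv_mult_cancel flip: \<open>h \<otimes> x = x \<otimes> h\<close>)
    moreover have "inv (h \<otimes> g) \<otimes> x \<otimes> (h \<otimes> g) = inv g \<otimes> (inv h \<otimes> x \<otimes> h) \<otimes> g"
      using hc g x by (simp add: m_assoc inv_mult_group)
    ultimately show "inv (h \<otimes> g) \<otimes> x \<otimes> (h \<otimes> g) = inv g \<otimes> x \<otimes> g" by simp
  qed
  moreover have "conj_class G x = (\<lambda>g. inv g \<otimes> x \<otimes> g) ` carrier G"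
    unfolding conj_class_def image_inv_reparam[of "\<lambda>g. g \<otimes> x \<otimes> inv g", symmetric] by simp
  ultimately show ?thesis by simp
qed

end

section \<open>Semidirect products\<close>

definition semidirect ::
    "('a, 'm) monoid_scheme \<Rightarrow> ('b, 'n) monoid_scheme \<Rightarrow> ('b \<Rightarrow> 'a \<Rightarrow> 'a) \<Rightarrow> ('a \<times> 'b) monoid"
  where "semidirect A H \<phi> = \<lparr>carrier = carrier A \<times> carrier H,
    monoid.mult = (\<lambda>(a, x) (b, y). (a \<otimes>\<^bsub>A\<^esub> \<phi> x b, x \<otimes>\<^bsub>H\<^esub> y)), one = (\<one>\<^bsub>A\<^esub>, \<one>\<^bsub>H\<^esub>)\<rparr>"

locale semidirect_product = A: group A + H: group H
  for A :: "('a, 'm) monoid_scheme" and H :: "('b, 'n) monoid_scheme" and \<phi> :: "'b \<Rightarrow> 'a \<Rightarrow> 'a" +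
  assumes act_closed [simp]: "x \<in> carrier H \<Longrightarrow> a \<in> carrier A \<Longrightarrow> \<phi> x a \<in> carrier A"
    and act_mult: "x \<in> carrier H \<Longrightarrow> a \<in> carrier A \<Longrightarrow> b \<in> carrier A \<Longrightarrow>
      \<phi> x (a \<otimes>\<^bsub>A\<^esub> b) = \<phi> x a \<otimes>\<^bsub>A\<^esub> \<phi> x b"
    and act_compose: "x \<in> carrier H \<Longrightarrow> y \<in> carrier H \<Longrightarrow> a \<in> carrier A \<Longrightarrow>
      \<phi> (x \<otimes>\<^bsub>H\<^esub> y) a = \<phi> x (\<phi> y a)"
    and act_id [simp]: "a \<in> carrier A \<Longrightarrow> \<phi> \<one>\<^bsub>H\<^esub> a = a"
begin

abbreviation "S \<equiv> semidirect A H \<phi>"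

lemma act_one [simp]:
  assumes "x \<in> carrier H" shows "\<phi> x \<one>\<^bsub>A\<^esub> = \<one>\<^bsub>A\<^esub>"
  using act_mult[OF assms A.one_closed A.one_closed] A.l_cancel_one assms by simp

lemma act_inv:
  assumes "x \<in> carrier H" "a \<in> carrier A" shows "\<phi> x (inv\<^bsub>A\<^esub> a) = inv\<^bsub>A\<^esub> (\<phi> x a)"
  using assms by (intro A.inv_equality[symmetric]) (simp_all flip: act_mult)

lemma carrier_semidirect [simp]: "carrier S = carrier A \<times> carrier H"
  and mult_semidirect [simp]: "(a, x) \<otimes>\<^bsub>S\<^esub> (b, y) = (a \<otimes>\<^bsub>A\<^esub> \<phi> x b, x \<otimes>\<^bsub>H\<^esub> y)"
  and one_semidirect [simp]: "\<one>\<^bsub>S\<^esub> = (\<one>\<^bsub>A\<^esub>, \<one>\<^bsub>H\<^esub>)"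
  by (simp_all add: semidirect_def)

lemma group_semidirect: "group S"
proof (rule groupI)
  fix p assume "p \<in> carrier S"
  then obtain a x where p: "p = (a, x)" "a \<in> carrier A" "x \<in> carrier H" by auto
  let ?q = "(\<phi> (inv\<^bsub>H\<^esub> x) (inv\<^bsub>A\<^esub> a), inv\<^bsub>H\<^esub> x)"
  have "?q \<otimes>\<^bsub>S\<^esub> p = \<one>\<^bsub>S\<^esub>" using p by (simp flip: act_mult)
  then show "\<exists>q\<in>carrier S. q \<otimes>\<^bsub>S\<^esub> p = \<one>\<^bsub>S\<^esub>" using p by (intro bexI[of _ ?q]) auto
qed (auto simp: act_mult act_compose A.m_assoc H.m_assoc)

lemma inv_semidirect:
  assumes "a \<in> carrier A" "x \<in> carrier H"
  shows "inv\<^bsub>S\<^esub> (a, x) = (\<phi> (inv\<^bsub>H\<^esub> x) (inv\<^bsub>A\<^esub> a), inv\<^bsub>H\<^esub> x)"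
  using assms by (intro group.inv_equality[OF group_semidirect]) (auto simp flip: act_mult)

text \<open>
  With \<open>z = y x y\<^sup>-\<^sup>1\<close> and \<open>c = \<phi>\<^sub>y(a)\<close>, the conjugate of \<open>(a, x)\<close> by \<open>(b, y)\<close> is \<open>(b c \<phi>\<^sub>z(b)\<^sup>-\<^sup>1, z)\<close>, and
  inserting \<open>b\<^sup>-\<^sup>1 b\<close> after \<open>c\<close> splits the first coordinate into a conjugate of \<open>c\<close> and a displacement
  of \<open>\<phi>\<^sub>z\<close>.
\<close>

lemma conj_class_semidirect_subset:
  assumes a: "a \<in> carrier A" and x: "x \<in> carrier H"
  shows "conj_class S (a, x) \<subseteq> (\<Union>z\<in>conj_class H x. \<Union>c\<in>(\<lambda>y. \<phi> y a) ` carrier H.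
    (\<lambda>(k, d). (k \<otimes>\<^bsub>A\<^esub> d, z)) `
      (conj_class A c \<times> (\<lambda>b. b \<otimes>\<^bsub>A\<^esub> inv\<^bsub>A\<^esub> (\<phi> z b)) ` carrier A))" (is "_ \<subseteq> ?R")
proof
  fix p assume "p \<in> conj_class S (a, x)"
  then obtain b y where b: "b \<in> carrier A" and y: "y \<in> carrier H"
    and p: "p = (b, y) \<otimes>\<^bsub>S\<^esub> (a, x) \<otimes>\<^bsub>S\<^esub> inv\<^bsub>S\<^esub> (b, y)" by (auto simp: conj_class_def)
  define z where "z = y \<otimes>\<^bsub>H\<^esub> x \<otimes>\<^bsub>H\<^esub> inv\<^bsub>H\<^esub> y"
  have z: "z \<in> carrier H" "z \<in> conj_class H x" using x y by (auto simp: z_def conj_class_def)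
  define c where "c = \<phi> y a"
  have c: "c \<in> carrier A" using a y c_def by simp
  have "p = (b \<otimes>\<^bsub>A\<^esub> c \<otimes>\<^bsub>A\<^esub> inv\<^bsub>A\<^esub> (\<phi> z b), z)"
    using a b x y unfolding p inv_semidirect[OF b y]
    by (simp add: z_def c_def act_inv act_compose)
  also have "b \<otimes>\<^bsub>A\<^esub> c \<otimes>\<^bsub>A\<^esub> inv\<^bsub>A\<^esub> (\<phi> z b) =
      (b \<otimes>\<^bsub>A\<^esub> c \<otimes>\<^bsub>A\<^esub> inv\<^bsub>A\<^esub> b) \<otimes>\<^bsub>A\<^esub> (b \<otimes>\<^bsub>A\<^esub> inv\<^bsub>A\<^esub> (\<phi> z b))"
    using b c z by (simp add: A.m_assoc A.inv_mult_cancel)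
  finally have "p = (\<lambda>(k, d). (k \<otimes>\<^bsub>A\<^esub> d, z))
      (b \<otimes>\<^bsub>A\<^esub> c \<otimes>\<^bsub>A\<^esub> inv\<^bsub>A\<^esub> b, b \<otimes>\<^bsub>A\<^esub> inv\<^bsub>A\<^esub> (\<phi> z b))" by simp
  moreover have "b \<otimes>\<^bsub>A\<^esub> c \<otimes>\<^bsub>A\<^esub> inv\<^bsub>A\<^esub> b \<in> conj_class A c" using b by (auto simp: conj_class_def)
  moreover have "c \<in> (\<lambda>y. \<phi> y a) ` carrier H" using y c_def by simp
  ultimately show "p \<in> ?R" using z(2) b by blast
qed

lemma finite_derived_semidirect:
  assumes "\<And>a. a \<in> carrier A \<Longrightarrow> size_le (conj_class A a) n"
    and "\<And>x. x \<in> carrier H \<Longrightarrow> size_le (conj_class H x) n"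
    and "\<And>a. a \<in> carrier A \<Longrightarrow> size_le ((\<lambda>y. \<phi> y a) ` carrier H) n"
    and "\<And>x. x \<in> carrier H \<Longrightarrow> size_le ((\<lambda>b. b \<otimes>\<^bsub>A\<^esub> inv\<^bsub>A\<^esub> (\<phi> x b)) ` carrier A) n"
  shows "finite (derived S (carrier S))"
proof -
  interpret G: group S by (rule group_semidirect)
  have "size_le (conj_class S p) (n * (n * (n * n)))" if p: "p \<in> carrier S" for p
  proof -
    obtain a x where ax: "p = (a, x)" "a \<in> carrier A" "x \<in> carrier H" using p by auto
    show ?thesis unfolding ax(1)
    proof (rule size_le_subset[OF _ conj_class_semidirect_subset[OF ax(2,3)]],
        rule size_le_UN[OF assms(2)[OF ax(3)]], rule size_le_UN[OF assms(3)[OF ax(2)]],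
        rule size_le_image, rule size_le_Times)
      fix z c assume z: "z \<in> conj_class H x" and c: "c \<in> (\<lambda>y. \<phi> y a) ` carrier H"
      show "size_le (conj_class A c) n" using assms(1) c ax(2) by auto
      show "size_le ((\<lambda>b. b \<otimes>\<^bsub>A\<^esub> inv\<^bsub>A\<^esub> (\<phi> z b)) ` carrier A) n"
        using assms(4) z ax(3) by (auto simp: conj_class_def)
    qed
  qed
  then show ?thesis
    by (intro G.finite_derived_if_finite_commutators G.finite_commutators_if_bounded_classes)
qed

text \<open>
  The embedding \<open>a \<mapsto> (a, 1)\<close> is an injective homomorphism, so it suffices to place the generators in
  the derived subgroup.
\<close>

lemma finite_generate_if_embeds:
  assumes K: "K \<subseteq> carrier A" and emb: "\<And>k. k \<in> K \<Longrightarrow> (k, \<one>\<^bsub>H\<^esub>) \<in> derived S (carrier S)"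
    and fin: "finite (derived S (carrier S))"
  shows "finite (generate A K)"
proof -
  interpret G: group S by (rule group_semidirect)
  let ?i = "\<lambda>a. (a, \<one>\<^bsub>H\<^esub>)"
  interpret i: group_hom A S ?i by unfold_locales (auto simp: hom_def)
  have "?i ` generate A K = generate S (?i ` K)" using i.generate_img[OF K] by simp
  also have "\<dots> \<subseteq> derived S (carrier S)"
    using emb G.derived_is_subgroup[of "carrier S"] by (intro G.generate_subgroup_incl) auto
  finally have "finite (?i ` generate A K)" using fin finite_subset by blast
  then show ?thesis by (rule finite_imageD) (auto simp: inj_on_def)
qed

text \<open>
  The element is the commutator of \<open>(1, x)\<close> and \<open>(b, 1)\<close>.
\<close>

lemma displacement_in_derived:
  assumes "b \<in> carrier A" "x \<in> carrier H"
  shows "(\<phi> x b \<otimes>\<^bsub>A\<^esub> inv\<^bsub>A\<^esub> b, \<one>\<^bsub>H\<^esub>) \<in> derived S (carrier S)"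
  using group.commutator_in_derived[OF group_semidirect, of "(\<one>\<^bsub>A\<^esub>, x)" "(b, \<one>\<^bsub>H\<^esub>)"] assms
  by (simp add: inv_semidirect)

lemma normal_factor_commutator_in_derived:
  assumes "a \<in> carrier A" "b \<in> carrier A"
  shows "(a \<otimes>\<^bsub>A\<^esub> b \<otimes>\<^bsub>A\<^esub> inv\<^bsub>A\<^esub> a \<otimes>\<^bsub>A\<^esub> inv\<^bsub>A\<^esub> b, \<one>\<^bsub>H\<^esub>) \<in> derived S (carrier S)"
  using group.commutator_in_derived[OF group_semidirect, of "(a, \<one>\<^bsub>H\<^esub>)" "(b, \<one>\<^bsub>H\<^esub>)"] assms
  by (simp add: inv_semidirect)

end

section \<open>Skew braces\<close>

text \<open>
  The map \<open>b \<mapsto> brace_action B a b\<close> is usually written \<open>\<lambda>\<^sub>a\<close>.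
\<close>

definition brace_action :: "('a, 'm) ring_scheme \<Rightarrow> 'a \<Rightarrow> 'a \<Rightarrow> 'a"
  where "brace_action B a b = \<ominus>\<^bsub>B\<^esub> a \<oplus>\<^bsub>B\<^esub> a \<otimes>\<^bsub>B\<^esub> b"

context skew_brace
begin

interpretation A: group "add_monoid B"
  rewrites "carrier (add_monoid B) = carrier B"
    and "monoid.mult (add_monoid B) = (\<oplus>)"
    and "one (add_monoid B) = \<zero>"
    and "m_inv (add_monoid B) = a_inv B"
  by (rule add_group) (simp_all add: a_inv_def fun_eq_iff)

interpretation M: group B by (rule mult_group)

abbreviation act where "act \<equiv> brace_action B"

lemma act_closed: "x \<in> carrier B \<Longrightarrow> a \<in> carrier B \<Longrightarrow> act x a \<in> carrier B"
  by (simp add: brace_action_def)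

lemma act_add:
  assumes "x \<in> carrier B" "a \<in> carrier B" "b \<in> carrier B"
  shows "act x (a \<oplus> b) = act x a \<oplus> act x b"
  using assms by (simp add: brace_action_def brace_distrib a_minus_def A.m_assoc)

lemma mult_eq_add_act:
  assumes "x \<in> carrier B" "a \<in> carrier B"
  shows "x \<otimes> a = x \<oplus> act x a"
  using assms by (simp add: brace_action_def A.inv_mult_cancel)

lemma act_compose:
  assumes x: "x \<in> carrier B" and y: "y \<in> carrier B" and a: "a \<in> carrier B"
  shows "act (x \<otimes> y) a = act x (act y a)"
proof -
  have "x \<otimes> y \<oplus> act (x \<otimes> y) a = x \<otimes> (y \<otimes> a)"
    using x y a by (simp add: M.m_assoc flip: mult_eq_add_act)
  also have "\<dots> = x \<oplus> act x (y \<oplus> act y a)"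
    using x y a by (simp add: mult_eq_add_act act_closed)
  also have "\<dots> = x \<otimes> y \<oplus> act x (act y a)"
    using x y a by (simp add: mult_eq_add_act act_closed act_add A.m_assoc)
  finally show ?thesis using x y a by (simp add: act_closed)
qed

lemma act_one: "a \<in> carrier B \<Longrightarrow> act \<one> a = a"
  using one_eq_zero by (simp add: brace_action_def)

lemma semidirect_brace: "semidirect_product (add_monoid B) B act"
  by (intro semidirect_product.intro semidirect_product_axioms.intro add_group mult_group)
    (simp_all add: act_closed act_add act_compose act_one)

lemma star_eq_act:
  "x \<star> b = act x b \<ominus> b"
  by (simp add: brace_star_def brace_action_def)

lemma star_zero_iff_act:
  assumes "x \<in> carrier B" "b \<in> carrier B"
  shows "x \<star> b = \<zero> \<longleftrightarrow> act x b = b"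
  using assms A.inv_solve_right'[of \<zero> "act x b" b]
  by (simp add: star_eq_act a_minus_def act_closed)

lemma act_minus:
  assumes "x \<in> carrier B" "a \<in> carrier B"
  shows "act x (\<ominus> a) = \<ominus> act x a"
  using semidirect_product.act_inv[OF semidirect_brace] assms by (simp add: a_inv_def)

text \<open>
  An index bounds the number of values of every function that is constant on the right cosets of the
  subgroup; each intersection in (BS) supplies two such functions. For \<open>Fix\<^sup>r(x)\<close> the relevant values are the \<open>-b + \<lambda>\<^sub>x(b)\<close>: they do not change when an element
  fixed by \<open>\<lambda>\<^sub>x\<close> is added to \<open>b\<close> on the left, and replacing \<open>b\<close> by \<open>-b\<close> turns them into \<open>b - \<lambda>\<^sub>x(b)\<close>.
\<close>

lemma finite_if_property_BS:
  assumes "property_BS B"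
  shows "finite (brace_square B)" "finite (add_commutator B)"
proof -
  interpret SD: semidirect_product "add_monoid B" B act by (rule semidirect_brace)
  obtain n where
    add_index: "\<And>x. x \<in> carrier B \<Longrightarrow>
      index_le (add_monoid B) (Fix_r B x \<inter> centraliser (add_monoid B) x) n" and
    mult_index: "\<And>x. x \<in> carrier B \<Longrightarrow> index_le B (Fix_l B x \<inter> centraliser B x) n"
    using assms by (auto simp: property_BS_def)
  have add_sub: "subgroup (Fix_r B x \<inter> centraliser (add_monoid B) x) (add_monoid B)"
    if "x \<in> carrier B" for x
    using that by (intro group.subgroups_Inter_pair[OF add_group] Fix_r_subgroup
        group.centraliser_subgroup[OF add_group]) auto
  have mult_sub: "subgroup (Fix_l B x \<inter> centraliser B x) B" if "x \<in> carrier B" for x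
    using that by (intro M.subgroups_Inter_pair Fix_l_subgroup M.centraliser_subgroup)
  have fin: "finite (derived SD.S (carrier SD.S))"
  proof (rule SD.finite_derived_semidirect[where n = n])
    fix a assume a: "a \<in> carrier B"
    show "size_le (conj_class (add_monoid B) a) n"
      using group.conj_class_size_le[OF add_group _ add_sub _ add_index] a by auto
    have "size_le ((\<lambda>y. act (inv y) a) ` carrier B) n"
    proof (rule M.size_le_image_if_index_le[OF mult_sub[OF a] mult_index[OF a]])
      fix h g assume h: "h \<in> Fix_l B a \<inter> centraliser B a" and g: "g \<in> carrier B"
      have "inv h \<in> Fix_l B a" using subgroup.m_inv_closed[OF mult_sub[OF a] h] by simp
      then have "act (inv h) a = a" "inv h \<in> carrier B"
        using a by (auto simp: Fix_l_def star_zero_iff_act)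
      moreover have "h \<in> carrier B" using h by (simp add: Fix_l_def)
      ultimately show "act (inv (h \<otimes> g)) a = act (inv g) a"
        using a g by (simp add: M.inv_mult_group act_compose)
    qed
    then show "size_le ((\<lambda>y. act y a) ` carrier B) n"
      by (simp only: M.image_inv_reparam[of "\<lambda>y. act y a"])
  next
    fix x assume x: "x \<in> carrier B"
    show "size_le (conj_class B x) n"
      using M.conj_class_size_le[OF x mult_sub[OF x] _ mult_index[OF x]] by simp
    have "size_le ((\<lambda>b. \<ominus> b \<oplus> act x b) ` carrier (add_monoid B)) n"
    proof (rule group.size_le_image_if_index_le[OF add_group add_sub[OF x] add_index[OF x]])
      fix h g assume h: "h \<in> Fix_r B x \<inter> centraliser (add_monoid B) x" and "g \<in> carrier (add_monoid B)"
      then have g: "g \<in> carrier B" and hc: "h \<in> carrier B" and "act x h = h"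
        using x by (auto simp: Fix_r_def star_zero_iff_act)
      then have "\<ominus> (h \<oplus> g) \<oplus> act x (h \<oplus> g) = \<ominus> g \<oplus> act x g"
        using x by (simp add: act_add act_closed A.inv_mult_group A.m_assoc A.inv_mult_cancel)
      then show "\<ominus> (h \<otimes>\<^bsub>add_monoid B\<^esub> g) \<oplus> act x (h \<otimes>\<^bsub>add_monoid B\<^esub> g) = \<ominus> g \<oplus> act x g"
        by simp
    qed
    then have "size_le ((\<lambda>b. \<ominus> (\<ominus> b) \<oplus> act x (\<ominus> b)) ` carrier B) n"
      using A.image_inv_reparam[of "\<lambda>b. \<ominus> b \<oplus> act x b"] by simp
    moreover have "(\<lambda>b. \<ominus> (\<ominus> b) \<oplus> act x (\<ominus> b)) ` carrier B = (\<lambda>b. b \<oplus> \<ominus> act x b) ` carrier B"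
      using x by (intro image_cong) (simp_all add: act_minus)
    ultimately show "size_le ((\<lambda>b. b \<oplus> \<ominus> act x b) ` carrier B) n" by simp
  qed
  show "finite (brace_square B)"
    unfolding brace_square_def
  proof (rule SD.finite_generate_if_embeds[OF _ _ fin])
    show "{a \<star> b |a b. a \<in> carrier B \<and> b \<in> carrier B} \<subseteq> carrier B"
      by (auto simp: star_eq_act act_closed a_minus_def)
    fix k assume "k \<in> {a \<star> b |a b. a \<in> carrier B \<and> b \<in> carrier B}"
    then obtain a b where "a \<in> carrier B" "b \<in> carrier B" "k = a \<star> b" by blast
    then show "(k, \<one>) \<in> derived SD.S (carrier SD.S)"
      using SD.displacement_in_derived[of b a] by (simp add: star_eq_act a_minus_def a_inv_def)
  qed
  show "finite (add_commutator B)"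
    unfolding add_commutator_def derived_def[of "add_monoid B"]
  proof (rule SD.finite_generate_if_embeds[OF _ _ fin])
    show "derived_set (add_monoid B) (carrier B) \<subseteq> carrier B"
      using group.derived_set_in_carrier[OF add_group, of "carrier B"] by simp
    fix k assume "k \<in> derived_set (add_monoid B) (carrier B)"
    then show "(k, \<one>) \<in> derived SD.S (carrier SD.S)"
      using SD.normal_factor_commutator_in_derived by (auto simp flip: a_inv_def)
  qed
qed

text \<open>
  The values \<open>x * (-b)\<close> and \<open>[-b, x]\<^sub>+\<close> are chosen with \<open>-b\<close> in place of \<open>b\<close> so that equal values put
  two elements into the same right, and not left, coset; the same holds for the inverse in the
  multiplicative part.
\<close>

lemma property_BS_if_finite:
  assumes finS: "finite (brace_square B)" and finD: "finite (add_commutator B)"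
  shows "property_BS B"
proof -
  let ?S = "brace_square B" and ?D = "add_commutator B"
  define p where "p = card ?S * card ?D"
  define q where "q = card ?S * card (?D \<times> ?S \<times> ?S)"
  have star_in: "x \<star> b \<in> ?S" if "x \<in> carrier B" "b \<in> carrier B" for x b
    unfolding brace_square_def using that by (intro generate.incl) blast
  have comm_in: "a \<oplus> b \<oplus> \<ominus> a \<oplus> \<ominus> b \<in> ?D" if "a \<in> carrier B" "b \<in> carrier B" for a b
    using group.commutator_in_derived[OF add_group, of a b] that
    by (simp add: add_commutator_def flip: a_inv_def)
  have "index_le (add_monoid B) (Fix_r B x \<inter> centraliser (add_monoid B) x) p"
    if x: "x \<in> carrier B" for x
  proof (rule group.index_le_if_separated[OF add_group,
        where f = "\<lambda>b. (x \<star> (\<ominus> b), \<ominus> b \<oplus> x \<oplus> b \<oplus> \<ominus> x)" and V = "?S \<times> ?D"])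
    show "subgroup (Fix_r B x \<inter> centraliser (add_monoid B) x) (add_monoid B)"
      using x by (intro group.subgroups_Inter_pair[OF add_group] Fix_r_subgroup
        group.centraliser_subgroup[OF add_group]) auto
    show "(\<lambda>b. (x \<star> (\<ominus> b), \<ominus> b \<oplus> x \<oplus> b \<oplus> \<ominus> x)) ` carrier (add_monoid B) \<subseteq> ?S \<times> ?D"
    proof
      fix v assume "v \<in> (\<lambda>b. (x \<star> (\<ominus> b), \<ominus> b \<oplus> x \<oplus> b \<oplus> \<ominus> x)) ` carrier (add_monoid B)"
      then obtain b where "b \<in> carrier B" "v = (x \<star> (\<ominus> b), \<ominus> b \<oplus> x \<oplus> b \<oplus> \<ominus> x)" by auto
      then show "v \<in> ?S \<times> ?D" using x star_in[of x "\<ominus> b"] comm_in[of "\<ominus> b" x] by simp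
    qed
    show "size_le (?S \<times> ?D) p"
      using finS finD by (simp add: size_le_def p_def card_cartesian_product)
  next
    fix g k assume "g \<in> carrier (add_monoid B)" "k \<in> carrier (add_monoid B)"
      and eq: "(x \<star> (\<ominus> g), \<ominus> g \<oplus> x \<oplus> g \<oplus> \<ominus> x) = (x \<star> (\<ominus> k), \<ominus> k \<oplus> x \<oplus> k \<oplus> \<ominus> x)"
    then have g: "g \<in> carrier B" and k: "k \<in> carrier B" by auto
    have 1: "\<ominus> act x g \<oplus> g = \<ominus> act x k \<oplus> k"
      using eq x g k by (simp add: star_eq_act a_minus_def act_minus)
    have "act x g \<oplus> (\<ominus> act x g \<oplus> g) \<oplus> \<ominus> k = act x g \<oplus> (\<ominus> act x k \<oplus> k) \<oplus> \<ominus> k"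
      by (simp only: 1)
    then have "g \<oplus> \<ominus> k = act x g \<oplus> \<ominus> act x k"
      using x g k by (simp add: act_closed A.m_assoc A.inv_mult_cancel)
    moreover have "act x (g \<oplus> \<ominus> k) = act x g \<oplus> \<ominus> act x k"
      using x g k by (simp add: act_add act_minus)
    ultimately have "act x (g \<oplus> \<ominus> k) = g \<oplus> \<ominus> k" by simp
    then have fixed: "g \<oplus> \<ominus> k \<in> Fix_r B x" using x g k by (simp add: Fix_r_def star_zero_iff_act)
    have "\<ominus> g \<oplus> x \<oplus> g = \<ominus> k \<oplus> x \<oplus> k" using eq x g k by simp
    then have "g \<oplus> (\<ominus> g \<oplus> x \<oplus> g) \<oplus> \<ominus> k = g \<oplus> (\<ominus> k \<oplus> x \<oplus> k) \<oplus> \<ominus> k" by simp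
    then have "g \<oplus> \<ominus> k \<oplus> x = x \<oplus> (g \<oplus> \<ominus> k)"
      using x g k by (simp add: A.m_assoc A.inv_mult_cancel)
    then show "g \<otimes>\<^bsub>add_monoid B\<^esub> inv\<^bsub>add_monoid B\<^esub> k \<in> Fix_r B x \<inter> centraliser (add_monoid B) x"
      using fixed g k by (simp add: centraliser_def flip: a_inv_def)
  qed
  moreover have "index_le B (Fix_l B x \<inter> centraliser B x) q" if x: "x \<in> carrier B" for x
  proof (rule M.index_le_if_separated)
    let ?f = "\<lambda>b. (act (inv b) x, inv b \<otimes> x \<otimes> b)"
    let ?V = "(\<lambda>s. s \<oplus> x) ` ?S \<times> (\<lambda>(c, s, t). c \<oplus> (s \<oplus> x) \<oplus> \<ominus> t) ` (?D \<times> ?S \<times> ?S)"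
    show "subgroup (Fix_l B x \<inter> centraliser B x) B"
      using x by (intro M.subgroups_Inter_pair Fix_l_subgroup M.centraliser_subgroup)
    show "?f ` carrier B \<subseteq> ?V"
    proof
      fix v assume "v \<in> ?f ` carrier B"
      then obtain g where g: "g \<in> carrier B" and v: "v = ?f g" by auto
      define b where "b = inv g"
      have b: "b \<in> carrier B" using g b_def by simp
      define y where "y = b \<otimes> x \<otimes> inv b"
      have y: "y \<in> carrier B" using b x y_def by simp
      have vy: "v = (act b x, y)" using v g by (simp add: y_def b_def)
      have act_star: "act u w = u \<star> w \<oplus> w" if "u \<in> carrier B" "w \<in> carrier B" for u w
        using that by (simp add: star_eq_act a_minus_def act_closed A.m_assoc)
      define s where "s = b \<star> x"
      define t where "t = y \<star> b"
      have st: "s \<in> carrier B" "t \<in> carrier B" using b x y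
        by (simp_all add: s_def t_def star_eq_act a_minus_def act_closed)
      \<comment> \<open>Writing \<open>y \<circ> b = b \<circ> x\<close> additively and solving for \<open>y\<close>.\<close>
      have "y \<otimes> b = b \<otimes> x" using b x by (simp add: y_def M.m_assoc)
      then have "y \<oplus> (t \<oplus> b) = b \<oplus> (s \<oplus> x)"
        using b x y by (simp add: mult_eq_add_act act_star s_def t_def)
      then have "y \<oplus> (t \<oplus> b) \<oplus> \<ominus> b \<oplus> \<ominus> t = b \<oplus> (s \<oplus> x) \<oplus> \<ominus> b \<oplus> \<ominus> t" by simp
      then have "y = b \<oplus> (s \<oplus> x) \<oplus> \<ominus> b \<oplus> \<ominus> t"
        using b x y st by (simp add: A.m_assoc A.inv_mult_cancel)
      also have "\<dots> = (b \<oplus> (s \<oplus> x) \<oplus> \<ominus> b \<oplus> \<ominus> (s \<oplus> x)) \<oplus> (s \<oplus> x) \<oplus> \<ominus> t"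
        using b x st by (simp add: A.m_assoc)
      finally have "y = (\<lambda>(c, s, t). c \<oplus> (s \<oplus> x) \<oplus> \<ominus> t)
          (b \<oplus> (s \<oplus> x) \<oplus> \<ominus> b \<oplus> \<ominus> (s \<oplus> x), s, t)" by simp
      moreover have "s \<in> ?S" "t \<in> ?S" using star_in b x y by (simp_all add: s_def t_def)
      moreover have "b \<oplus> (s \<oplus> x) \<oplus> \<ominus> b \<oplus> \<ominus> (s \<oplus> x) \<in> ?D" using comm_in b x st by simp
      moreover have "act b x = s \<oplus> x" using act_star b x s_def by simp
      ultimately show "v \<in> ?V" unfolding vy by blast
    qed
    show "size_le ?V q"
      unfolding q_def using finS finD by (intro size_le_Times size_le_image) (auto simp: size_le_def)
  next
    fix g k assume g: "g \<in> carrier B" and k: "k \<in> carrier B"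
      and eq: "(act (inv g) x, inv g \<otimes> x \<otimes> g) = (act (inv k) x, inv k \<otimes> x \<otimes> k)"
    have "act (g \<otimes> inv k) x = act g (act (inv g) x)"
      using eq g k x by (simp add: act_compose)
    also have "\<dots> = x" using g x by (simp add: act_one flip: act_compose)
    finally have fixed: "g \<otimes> inv k \<in> Fix_l B x" using g k x by (simp add: Fix_l_def star_zero_iff_act)
    have "g \<otimes> (inv g \<otimes> x \<otimes> g) \<otimes> inv k = g \<otimes> (inv k \<otimes> x \<otimes> k) \<otimes> inv k" using eq by simp
    then have "g \<otimes> inv k \<otimes> x = x \<otimes> (g \<otimes> inv k)"
      using x g k by (simp add: M.m_assoc M.inv_mult_cancel)
    then show "g \<otimes> inv k \<in> Fix_l B x \<inter> centraliser B x" using fixed g k by (simp add: centraliser_def)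
  qed
  ultimately show ?thesis
    unfolding property_BS_def by (intro exI[of _ "Suc (p + q)"])
      (auto simp: index_le_def intro: le_SucI trans_le_add1 trans_le_add2)
qed

end

theorem theorem4p2:
  fixes B :: "('a, 'm) ring_scheme"
  assumes "skew_brace B"
  shows "property_BS B \<longleftrightarrow> finite (brace_square B) \<and> finite (add_commutator B)"
  using skew_brace.finite_if_property_BS[OF assms] skew_brace.property_BS_if_finite[OF assms]
  by blast

end
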